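(* Let $0<p<2$. Let $\Omega$ be a bounded pseudoconvex domain in $\mathbb{C}^n$, $S$ a closed complex submanifold of $\Omega$ of codimension $k$, $\varphi$ a plurisubharmonic function on $\Omega$, and $B$ the continuous function on $\Omega$ associated with $(\Omega,S)$ as described in the context. Let $f$ be a holomorphic function on $S$ with $$\int_S|f|^pe^{-\varphi+kB}<\infty .$$ Then any minimal extension $F_{p,\varphi}\in A^p(\Omega,\varphi)$ of $f$ satisfies $$F_{p,\varphi}=F_{2,\widetilde{\varphi}_p},\qquad\text{where}\quad \widetilde{\varphi}_p:=\varphi+(2-p)\log|F_{p,\varphi}|,$$ and $F_{2,\widetilde{\varphi}_p}\in A^2(\Omega,\widetilde{\varphi}_p)$ denotes the minimal extension of $f$ in $A^2(\Omega,\widetilde{\varphi}_p)$.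
   Context: Integrals over $\Omega$ are with respect to Lebesgue measure, and integrals over $S$ are with respect to the volume measure on $S$ induced by the Euclidean metric of $\mathbb{C}^n$. For $q>0$ and a weight function $\psi:\Omega\to[-\infty,\infty)$, the weighted $q$-Bergman space is $$A^q(\Omega,\psi):=\Big\{g\in\mathcal{O}(\Omega):\ \int_\Omega|g|^qe^{-\psi}<\infty\Big\}.$$ For a holomorphic function $f$ on $S$ put $$E^q(f,S,\psi):=\{g\in A^q(\Omega,\psi):\ g|_S=f\}.$$ A minimal extension of $f$ in $A^q(\Omega,\psi)$ is an element $F_{q,\psi}\in E^q(f,S,\psi)$ such that $\int_\Omega|F_{q,\psi}|^qe^{-\psi}\le\int_\Omega|g|^qe^{-\psi}$ for all $g\in E^q(f,S,\psi)$. It is unique when $q\ge1$ (in particular for $q=2$); for $0<q<1$ uniqueness is not claimed. For the weight $\widetilde{\varphi}_p$ one has $e^{-\widetilde{\varphi}_p}=|F_{p,\varphi}|^{p-2}e^{-\varphi}$, with the conventions $\log 0=-\infty$ and $0\cdot\infty=0$. The function $B$: it is a fixed continuous real-valued function on $\Omega$, determined by the geometry of $\Omega$ and $S$, for which the Ohsawa-Takegoshi extension theorem holds in the following form. For every $0<q\le2$, every plurisubharmonic function $\psi$ on $\Omega$, and every holomorphic function $f$ on $S$ with $\int_S|f|^qe^{-\psi+kB}<\infty$, there exists $F\in A^q(\Omega,\psi)$ with $F|_S=f$ and $$\int_\Omega|F|^qe^{-\psi}\le\sigma_k\int_S|f|^qe^{-\psi+kB},$$ where $\sigma_k$ is the volume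 of the unit ball in $\mathbb{C}^k$. *)

theory Defs
  imports "HOL-Analysis.Analysis"
begin

section \<open>Holomorphic functions of several variables\<close>

definition holomorphic_Cn :: "(complex ^ 'n \<Rightarrow> complex) \<Rightarrow> (complex ^ 'n) set \<Rightarrow> bool" where
  "holomorphic_Cn f U \<longleftrightarrow>
     (\<forall>z\<in>U. \<exists>D. (f has_derivative D) (at z) \<and> (\<forall>c v. D (c *s v) = c * D v))"

definition holomorphic_map :: "(complex ^ 'n \<Rightarrow> complex ^ 'n) \<Rightarrow> (complex ^ 'n) set \<Rightarrow> bool" where
  "holomorphic_map F U \<longleftrightarrow> (\<forall>i. holomorphic_Cn (\<lambda>z. F z $ i) U)"

section \<open>Plurisubharmonic functions and pseudoconvex domains\<close>

text \<open>The integral of an extended real function, meant for functions whose positive part has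
  finite integral; the value may be \<open>-\<infinity>\<close>.\<close>

definition ereal_integral :: "'a measure \<Rightarrow> ('a \<Rightarrow> ereal) \<Rightarrow> ereal" where
  "ereal_integral M f =
     enn2ereal (\<integral>\<^sup>+x. e2ennreal (f x) \<partial>M) - enn2ereal (\<integral>\<^sup>+x. e2ennreal (- f x) \<partial>M)"

definition circle_mean :: "(complex ^ 'n \<Rightarrow> ereal) \<Rightarrow> complex ^ 'n \<Rightarrow> complex ^ 'n \<Rightarrow> ereal" where
  "circle_mean u a w =
     ereal_integral (lebesgue_on {0..2 * pi}) (\<lambda>t. u (a + cis t *s w)) / ereal (2 * pi)"

definition upper_semicontinuous_on :: "'a::topological_space set \<Rightarrow> ('a \<Rightarrow> ereal) \<Rightarrow> bool" where
  "upper_semicontinuous_on U u \<longleftrightarrow> (\<forall>a\<in>U. \<forall>c>u a. \<forall>\<^sub>F z in at a within U. u z < c)"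

text \<open>As usual, the constant \<open>-\<infinity>\<close> counts as plurisubharmonic. Only the values on the open
  set \<open>U\<close> matter.\<close>

definition plurisubharmonic_on :: "(complex ^ 'n) set \<Rightarrow> (complex ^ 'n \<Rightarrow> ereal) \<Rightarrow> bool" where
  "plurisubharmonic_on U u \<longleftrightarrow>
     (\<forall>z\<in>U. u z < \<infinity>) \<and>
     upper_semicontinuous_on U u \<and>
     (\<forall>a w. (\<forall>\<zeta>. cmod \<zeta> \<le> 1 \<longrightarrow> a + \<zeta> *s w \<in> U) \<longrightarrow> u a \<le> circle_mean u a w)"

definition pseudoconvex :: "(complex ^ 'n) set \<Rightarrow> bool" where
  "pseudoconvex \<Omega> \<longleftrightarrow>
     (\<exists>u :: complex ^ 'n \<Rightarrow> real.
        continuous_on \<Omega> u \<and> plurisubharmonic_on \<Omega> (\<lambda>z. ereal (u z)) \<and>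
        (\<forall>c. \<exists>K. compact K \<and> {z \<in> \<Omega>. u z < c} \<subseteq> K \<and> K \<subseteq> \<Omega>))"

definition bounded_pseudoconvex_domain :: "(complex ^ 'n) set \<Rightarrow> bool" where
  "bounded_pseudoconvex_domain \<Omega> \<longleftrightarrow>
     open \<Omega> \<and> connected \<Omega> \<and> \<Omega> \<noteq> {} \<and> bounded \<Omega> \<and> pseudoconvex \<Omega>"

section \<open>Complex submanifolds, their holomorphic functions and their volume\<close>

text \<open>The point with coordinates \<open>0\<close> in the directions \<open>I\<close> and \<open>x j\<close> in the directions
  \<open>j \<notin> I\<close>. Thus \<open>x\<close>, read on \<open>- I\<close>, stands for a point of the complex space of dimension
  \<open>card (- I)\<close>, which is allowed to be \<open>0\<close>.\<close>

definition slice_point :: "'n set \<Rightarrow> ('n \<Rightarrow> complex) \<Rightarrow> complex ^ 'n" where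
  "slice_point I x = (\<chi> j. if j \<in> I then 0 else x j)"

text \<open>\<open>\<Phi> : U \<rightarrow> V\<close> is biholomorphic with inverse \<open>\<Psi>\<close> and carries \<open>S \<inter> U\<close> to the coordinate
  slice of codimension \<open>k\<close> on which the coordinates in \<open>I\<close> vanish.\<close>

definition slice_chart ::
  "(complex ^ 'n) set \<Rightarrow> nat \<Rightarrow> 'n set \<Rightarrow> (complex ^ 'n) set \<Rightarrow> (complex ^ 'n) set \<Rightarrow>
   (complex ^ 'n \<Rightarrow> complex ^ 'n) \<Rightarrow> (complex ^ 'n \<Rightarrow> complex ^ 'n) \<Rightarrow> bool" where
  "slice_chart S k I U V \<Phi> \<Psi> \<longleftrightarrow>
     card I = k \<and> open U \<and> open V \<and> holomorphic_map \<Phi> U \<and> holomorphic_map \<Psi> V \<and>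
     \<Phi> ` U = V \<and> \<Psi> ` V = U \<and> (\<forall>z\<in>U. \<Psi> (\<Phi> z) = z) \<and> (\<forall>w\<in>V. \<Phi> (\<Psi> w) = w) \<and>
     \<Phi> ` (S \<inter> U) = {w \<in> V. \<forall>i\<in>I. w $ i = 0}"

definition closed_complex_submanifold ::
  "(complex ^ 'n) set \<Rightarrow> nat \<Rightarrow> (complex ^ 'n) set \<Rightarrow> bool" where
  "closed_complex_submanifold \<Omega> k S \<longleftrightarrow>
     closedin (top_of_set \<Omega>) S \<and>
     (\<forall>a\<in>S. \<exists>I U V \<Phi> \<Psi>. a \<in> U \<and> slice_chart S k I U V \<Phi> \<Psi>)"

text \<open>Holomorphy in the local coordinates \<open>(w\<^sub>j)\<close>, \<open>j \<notin> I\<close>, of every chart: the function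
  below does not depend on the coordinates \<open>w\<^sub>i\<close> with \<open>i \<in> I\<close>.\<close>

definition holomorphic_on_submanifold ::
  "(complex ^ 'n) set \<Rightarrow> nat \<Rightarrow> (complex ^ 'n \<Rightarrow> complex) \<Rightarrow> bool" where
  "holomorphic_on_submanifold S k f \<longleftrightarrow>
     (\<forall>I U V \<Phi> \<Psi>. slice_chart S k I U V \<Phi> \<Psi> \<longrightarrow>
        holomorphic_Cn (\<lambda>w. f (\<Psi> (slice_point I (vec_nth w))))
                       {w. slice_point I (vec_nth w) \<in> V})"

text \<open>The real coordinate vectors: \<open>\<partial>/\<partial>x\<^sub>j\<close> for \<open>(j, False)\<close> and \<open>\<partial>/\<partial>y\<^sub>j\<close> for \<open>(j, True)\<close>.\<close>

definition real_direction :: "'n \<times> bool \<Rightarrow> complex ^ 'n" where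
  "real_direction a = axis (fst a) (if snd a then \<i> else 1)"

text \<open>\<open>sqrt (det (g\<^sub>a\<^sub>b))\<close> for the Riemannian metric \<open>g\<close> which the Euclidean inner product induces
  on the slice via \<open>\<Psi>\<close>. The Gram matrix, indexed by the directions outside \<open>I\<close>, is filled up
  with an identity block, which does not change its determinant.\<close>

definition volume_density ::
  "'n::finite set \<Rightarrow> (complex ^ 'n \<Rightarrow> complex ^ 'n) \<Rightarrow> complex ^ 'n \<Rightarrow> real" where
  "volume_density I \<Psi> w =
     sqrt (det ((\<chi> a b.
        if fst a \<notin> I \<and> fst b \<notin> I
        then frechet_derivative \<Psi> (at w) (real_direction a) \<bullet>
             frechet_derivative \<Psi> (at w) (real_direction b)
        else if a = b then 1 else 0) :: real ^ ('n \<times> bool) ^ ('n \<times> bool)))"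

text \<open>The volume measure is the Borel measure on \<open>S\<close> that is given by the volume density in every
  chart; it is unique since countably many charts cover \<open>S\<close>. For discrete \<open>S\<close> it is the
  counting measure.\<close>

definition is_volume_measure ::
  "(complex ^ 'n) set \<Rightarrow> nat \<Rightarrow> (complex ^ 'n) measure \<Rightarrow> bool" where
  "is_volume_measure S k \<mu> \<longleftrightarrow>
     space \<mu> = S \<and> sets \<mu> = sets (restrict_space borel S) \<and>
     (\<forall>I U V \<Phi> \<Psi>. slice_chart S k I U V \<Phi> \<Psi> \<longrightarrow>
        (\<forall>A\<in>sets \<mu>. A \<subseteq> U \<longrightarrow>
           emeasure \<mu> A =
             (\<integral>\<^sup>+x. (if slice_point I x \<in> V \<and> \<Psi> (slice_point I x) \<in> A
                   then ennreal (volume_density I \<Psi> (slice_point I x)) else 0)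
               \<partial>Pi\<^sub>M (- I) (\<lambda>_. lborel))))"

definition volume_measure :: "(complex ^ 'n) set \<Rightarrow> nat \<Rightarrow> (complex ^ 'n) measure" where
  "volume_measure S k = (THE \<mu>. is_volume_measure S k \<mu>)"

section \<open>Weighted Bergman spaces and minimal extensions\<close>

definition exp_ereal :: "ereal \<Rightarrow> ennreal" where
  "exp_ereal x = (case x of ereal r \<Rightarrow> ennreal (exp r) | PInfty \<Rightarrow> \<infinity> | MInfty \<Rightarrow> 0)"

definition log_abs :: "complex \<Rightarrow> ereal" where
  "log_abs c = (if c = 0 then - \<infinity> else ereal (ln (cmod c)))"

text \<open>In \<^typ>\<open>ennreal\<close> one has \<open>0 * \<infinity> = 0\<close>, so zeros of \<open>g\<close> where the weight is \<open>-\<infinity>\<close>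
  contribute nothing to the following integrals.\<close>

definition weighted_integral ::
  "real \<Rightarrow> (complex ^ 'n) set \<Rightarrow> (complex ^ 'n \<Rightarrow> ereal) \<Rightarrow> (complex ^ 'n \<Rightarrow> complex) \<Rightarrow> ennreal" where
  "weighted_integral q \<Omega> \<psi> g =
     (\<integral>\<^sup>+z\<in>\<Omega>. ennreal (cmod (g z) powr q) * exp_ereal (- \<psi> z) \<partial>lebesgue)"

definition submanifold_integral ::
  "real \<Rightarrow> (complex ^ 'n) set \<Rightarrow> nat \<Rightarrow> (complex ^ 'n \<Rightarrow> real) \<Rightarrow> (complex ^ 'n \<Rightarrow> ereal) \<Rightarrow>
   (complex ^ 'n \<Rightarrow> complex) \<Rightarrow> ennreal" where
  "submanifold_integral q S k B \<psi> f =
     (\<integral>\<^sup>+z. ennreal (cmod (f z) powr q) * exp_ereal (- \<psi> z + ereal (real k * B z))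
        \<partial>volume_measure S k)"

definition bergman_space ::
  "real \<Rightarrow> (complex ^ 'n) set \<Rightarrow> (complex ^ 'n \<Rightarrow> ereal) \<Rightarrow> (complex ^ 'n \<Rightarrow> complex) set" where
  "bergman_space q \<Omega> \<psi> = {g. holomorphic_Cn g \<Omega> \<and> weighted_integral q \<Omega> \<psi> g < \<infinity>}"

definition extensions ::
  "real \<Rightarrow> (complex ^ 'n) set \<Rightarrow> (complex ^ 'n) set \<Rightarrow> (complex ^ 'n \<Rightarrow> ereal) \<Rightarrow>
   (complex ^ 'n \<Rightarrow> complex) \<Rightarrow> (complex ^ 'n \<Rightarrow> complex) set" where
  "extensions q \<Omega> S \<psi> f = {g \<in> bergman_space q \<Omega> \<psi>. \<forall>z\<in>S. g z = f z}"

definition minimal_extension ::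
  "real \<Rightarrow> (complex ^ 'n) set \<Rightarrow> (complex ^ 'n) set \<Rightarrow> (complex ^ 'n \<Rightarrow> ereal) \<Rightarrow>
   (complex ^ 'n \<Rightarrow> complex) \<Rightarrow> (complex ^ 'n \<Rightarrow> complex) \<Rightarrow> bool" where
  "minimal_extension q \<Omega> S \<psi> f F \<longleftrightarrow>
     F \<in> extensions q \<Omega> S \<psi> f \<and>
     (\<forall>g\<in>extensions q \<Omega> S \<psi> f. weighted_integral q \<Omega> \<psi> F \<le> weighted_integral q \<Omega> \<psi> g)"

text \<open>The real dimension of \<open>\<complex>\<^sup>k\<close> is \<open>2 * k\<close>.\<close>

definition ohsawa_takegoshi_function ::
  "(complex ^ 'n) set \<Rightarrow> (complex ^ 'n) set \<Rightarrow> nat \<Rightarrow> (complex ^ 'n \<Rightarrow> real) \<Rightarrow> bool" where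
  "ohsawa_takegoshi_function \<Omega> S k B \<longleftrightarrow>
     continuous_on \<Omega> B \<and>
     (\<forall>q \<psi> f. 0 < q \<and> q \<le> 2 \<and> plurisubharmonic_on \<Omega> \<psi> \<and> holomorphic_on_submanifold S k f \<and>
        submanifold_integral q S k B \<psi> f < \<infinity> \<longrightarrow>
        (\<exists>F\<in>bergman_space q \<Omega> \<psi>. (\<forall>z\<in>S. F z = f z) \<and>
           weighted_integral q \<Omega> \<psi> F
             \<le> ennreal (unit_ball_vol (2 * real k)) * submanifold_integral q S k B \<psi> f))"

definition twisted_weight ::
  "real \<Rightarrow> (complex ^ 'n \<Rightarrow> ereal) \<Rightarrow> (complex ^ 'n \<Rightarrow> complex) \<Rightarrow> complex ^ 'n \<Rightarrow> ereal" where
  "twisted_weight p \<phi> F z = \<phi> z + ereal (2 - p) * log_abs (F z)"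

end

theory Submission
  imports Defs
begin

text \<open>Young's inequality \<open>|g|\<^sup>p \<le> p/2 |g|\<^sup>2 |F|\<^bsup>p-2\<^esup> + (1 - p/2) |F|\<^sup>p\<close> bounds the \<open>p\<close>-norm of a competitor
  \<open>g\<close> in the twisted \<open>L\<^sup>2\<close>-space, so that \<open>g\<close> competes with \<open>F\<close> in the \<open>p\<close>-problem as well; since
  the twisted \<open>L\<^sup>2\<close>-integral of \<open>F\<close> equals its \<open>p\<close>-integral, minimality of \<open>F\<close> for \<open>p\<close> yields
  minimality for \<open>2\<close>. Uniqueness is the parallelogram law.\<close>

text \<open>Weighted arithmetic-geometric mean inequality with weights \<open>p / 2\<close> and
  \<open>1 - p / 2\<close>, for the numbers \<open>a powr 2 * b powr (p - 2)\<close> and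
  \<open>b powr p\<close>. Positivity of \<open>b\<close> matters: since
  \<open>0 powr x = 0\<close>, the right side would vanish at \<open>b = 0\<close>.\<close>

lemma young_powr:
  fixes a b p :: real
  assumes "0 < p" "p < 2" "0 \<le> a" "0 < b"
  shows "a powr p \<le> p / 2 * (a powr 2 * b powr (p - 2)) + (1 - p / 2) * b powr p"
proof (cases "a = 0")
  case True
  then show ?thesis using assms by simp
next
  case False
  let ?x = "a powr 2 * b powr (p - 2)"
  \<comment> \<open>The weights are chosen so that the total exponent of \<open>b\<close> is
    \<open>0\<close> and only \<open>a powr p\<close> survives.\<close>
  have "?x powr (p / 2) * (b powr p) powr (1 - p / 2)
      = a powr p * (b powr ((p - 2) * (p / 2)) * b powr (p * (1 - p / 2)))"
    using assms by (simp add: powr_mult powr_powr del: powr_numeral)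
  also have "\<dots> = a powr p * b powr ((p - 2) * (p / 2) + p * (1 - p / 2))"
    by (simp only: powr_add)
  also have "(p - 2) * (p / 2) + p * (1 - p / 2) = 0"
    by (simp add: field_simps)
  finally have "a powr p = ?x powr (p / 2) * (b powr p) powr (1 - p / 2)"
    using assms by simp
  also have "\<dots> \<le> p / 2 * ?x + (1 - p / 2) * b powr p"
    using assms False by (intro Youngs_inequality_0) auto
  finally show ?thesis .
qed

lemma exp_ereal_measurable [measurable]: "exp_ereal \<in> borel_measurable borel"
proof -
  have "exp_ereal = (\<lambda>x. if x = \<infinity> then \<infinity> else if x = - \<infinity> then 0 else ennreal (exp (real_of_ereal x)))"
    by (auto simp: exp_ereal_def fun_eq_iff split: ereal.split)
  also have "\<dots> \<in> borel_measurable borel" by measurable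
  finally show ?thesis .
qed

lemma log_abs_measurable [measurable]: "log_abs \<in> borel_measurable borel"
  unfolding log_abs_def by measurable

text \<open>The zeros of \<open>F\<close> need their own case, because \<open>0 powr (p - 2)\<close>
  is \<open>0\<close> whereas the weight is infinite there. The bound on \<open>\<phi> z\<close>
  excludes the sum of \<open>\<infinity>\<close> and \<open>- \<infinity>\<close>, which evaluates
  to \<open>\<infinity>\<close>.\<close>

lemma exp_ereal_twisted_weight:
  assumes "p < 2" and "\<phi> z < \<infinity>"
  shows "exp_ereal (- twisted_weight p \<phi> F z) =
    (if F z = 0 then \<infinity> else ennreal (cmod (F z) powr (p - 2)) * exp_ereal (- \<phi> z))"
proof (cases "\<phi> z")
  case (real r)
  then show ?thesis using assms(1)
    by (simp add: twisted_weight_def log_abs_def exp_ereal_def powr_def algebra_simps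
        flip: ennreal_mult exp_add)
next
  case MInf
  then show ?thesis using assms(1)
    by (simp add: twisted_weight_def log_abs_def exp_ereal_def ennreal_mult_top)
qed (use assms in simp)

text \<open>Strict sublevel sets are open. The filter \<open>at a\<close> says nothing about
  \<open>a\<close> itself, so the neighbourhood is completed by \<open>u a < c\<close>.\<close>

lemma upper_semicontinuous_on_borel_measurable:
  fixes u :: "'a::euclidean_space \<Rightarrow> ereal"
  assumes "open U" "upper_semicontinuous_on U u"
  shows "u \<in> borel_measurable (lebesgue_on U)"
proof (rule borel_measurableI_less)
  fix c
  have "open {z \<in> U. u z < c}"
  proof (subst open_subopen, safe)
    fix a assume a: "a \<in> U" "u a < c"
    then have "\<forall>\<^sub>F z in at a. u z < c"
      using assms(2) at_within_open[OF a(1) assms(1)]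
      by (fastforce simp: upper_semicontinuous_on_def)
    then obtain T where "open T" "a \<in> T" "\<And>z. z \<in> T \<Longrightarrow> z \<noteq> a \<Longrightarrow> u z < c"
      unfolding eventually_at_topological by blast
    then show "\<exists>T. open T \<and> a \<in> T \<and> T \<subseteq> {z \<in> U. u z < c}"
      using a assms(1) by (intro exI[of _ "T \<inter> U"]) auto
  qed
  moreover have "{z \<in> space (lebesgue_on U). u z < c} = {z \<in> U. u z < c}"
    by auto
  ultimately show "{z \<in> space (lebesgue_on U). u z < c} \<in> sets (lebesgue_on U)"
    using assms(1) by (auto simp: sets_restrict_space_iff)
qed

lemma holomorphic_Cn_continuous_on: "holomorphic_Cn f U \<Longrightarrow> continuous_on U f"
  unfolding holomorphic_Cn_def
  by (meson continuous_at_imp_continuous_on has_derivative_continuous)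

lemma holomorphic_Cn_add:
  "holomorphic_Cn f U \<Longrightarrow> holomorphic_Cn g U \<Longrightarrow> holomorphic_Cn (\<lambda>z. f z + g z) U"
  unfolding holomorphic_Cn_def
proof safe
  fix z assume "\<forall>z\<in>U. \<exists>D. (f has_derivative D) (at z) \<and> (\<forall>c v. D (c *s v) = c * D v)"
    "\<forall>z\<in>U. \<exists>D. (g has_derivative D) (at z) \<and> (\<forall>c v. D (c *s v) = c * D v)" "z \<in> U"
  then obtain D E where "(f has_derivative D) (at z)" "\<forall>c v. D (c *s v) = c * D v"
    "(g has_derivative E) (at z)" "\<forall>c v. E (c *s v) = c * E v" by meson
  then show "\<exists>D. ((\<lambda>z. f z + g z) has_derivative D) (at z) \<and> (\<forall>c v. D (c *s v) = c * D v)"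
    by (intro exI[of _ "\<lambda>v. D v + E v"]) (auto intro: has_derivative_add simp: algebra_simps)
qed

lemma holomorphic_Cn_cmult:
  "holomorphic_Cn f U \<Longrightarrow> holomorphic_Cn (\<lambda>z. a * f z) U"
  unfolding holomorphic_Cn_def
proof safe
  fix z assume "\<forall>z\<in>U. \<exists>D. (f has_derivative D) (at z) \<and> (\<forall>c v. D (c *s v) = c * D v)" "z \<in> U"
  then obtain D where "(f has_derivative D) (at z)" "\<forall>c v. D (c *s v) = c * D v" by meson
  then show "\<exists>D. ((\<lambda>z. a * f z) has_derivative D) (at z) \<and> (\<forall>c v. D (c *s v) = c * D v)"
    by (intro exI[of _ "\<lambda>v. a * D v"]) (auto intro: has_derivative_mult_right)
qed

lemma weighted_integral_lebesgue_on:
  assumes "open \<Omega>"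
  shows "weighted_integral q \<Omega> \<psi> g =
    (\<integral>\<^sup>+z. ennreal (cmod (g z) powr q) * exp_ereal (- \<psi> z) \<partial>lebesgue_on \<Omega>)"
  using assms unfolding weighted_integral_def by (subst nn_integral_restrict_space) auto

lemma holomorphic_Cn_measurable:
  "open U \<Longrightarrow> holomorphic_Cn f U \<Longrightarrow> f \<in> borel_measurable (lebesgue_on U)"
  by (auto intro!: continuous_imp_measurable_on_sets_lebesgue holomorphic_Cn_continuous_on)

text \<open>The set where the functions differ is open by continuity and negligible by assumption,
  and a nonempty open set is not negligible.\<close>

lemma AE_eq_imp_eq_on_open:
  fixes f g :: "'a::euclidean_space \<Rightarrow> 'b::real_normed_vector"
  assumes "open U" "continuous_on U f" "continuous_on U g"
    and "AE z in lebesgue_on U. f z = g z" and "z \<in> U"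
  shows "f z = g z"
proof -
  have "open ((\<lambda>z. f z - g z) -` (- {0}) \<inter> U)"
    using assms(1-3)
    by (intro continuous_on_open_vimage[THEN iffD1, rule_format] continuous_intros) auto
  moreover have "(\<lambda>z. f z - g z) -` (- {0}) \<inter> U = {z \<in> U. f z \<noteq> g z}"
    by auto
  ultimately have op: "open {z \<in> U. f z \<noteq> g z}" by simp
  have "AE z in lebesgue. z \<in> U \<longrightarrow> f z = g z"
    using assms(1,4) by (subst (asm) AE_restrict_space_iff) auto
  then obtain N where "negligible N" "{z \<in> U. f z \<noteq> g z} \<subseteq> N"
    by (auto simp: eventually_ae_filter_negligible Collect_imp_eq[symmetric])
  then have "negligible {z \<in> U. f z \<noteq> g z}" by (rule negligible_subset)
  with op have "{z \<in> U. f z \<noteq> g z} = {}" by (metis open_not_negligible)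
  then show ?thesis using assms(5) by auto
qed

text \<open>The midpoint \<open>H\<close> of two minimizers is again a competitor, so by the
  parallelogram law the half-difference \<open>K\<close> has integral \<open>0\<close>. As
  \<open>\<psi>\<close> is never \<open>\<infinity>\<close>, the density is positive and
  \<open>K\<close> vanishes almost everywhere, hence everywhere by continuity.\<close>

lemma minimal_extension_2_unique:
  fixes \<Omega> :: "(complex ^ 'n) set"
  assumes \<Omega>: "open \<Omega>" and \<psi>: "\<psi> \<in> borel_measurable (lebesgue_on \<Omega>)"
    and fin: "\<And>z. z \<in> \<Omega> \<Longrightarrow> \<psi> z < \<infinity>"
    and F: "minimal_extension 2 \<Omega> S \<psi> f F" and G: "minimal_extension 2 \<Omega> S \<psi> f G"
    and z: "z \<in> \<Omega>"
  shows "F z = G z"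
proof -
  let ?W = "weighted_integral 2 \<Omega> \<psi>"
  let ?e = "\<lambda>z. exp_ereal (- \<psi> z)"
  define H where "H = (\<lambda>z. 1/2 * F z + 1/2 * G z)"
  define K where "K = (\<lambda>z. 1/2 * F z + (-1/2) * G z)"
  note defs = minimal_extension_def extensions_def bergman_space_def
  have hol: "holomorphic_Cn F \<Omega>" "holomorphic_Cn G \<Omega>"
    using F G by (auto simp: defs)
  have holH: "holomorphic_Cn H \<Omega>" "holomorphic_Cn K \<Omega>"
    unfolding H_def K_def by (intro holomorphic_Cn_add holomorphic_Cn_cmult hol)+
  note [measurable] = \<psi> hol[THEN holomorphic_Cn_measurable[OF \<Omega>]]
    holH[THEN holomorphic_Cn_measurable[OF \<Omega>]]
  \<comment> \<open>Written without subtraction, the parallelogram law holds in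
    \<open>ennreal\<close> even where the weight factor is infinite.\<close>
  have ptw: "2 * (ennreal (cmod (H z) powr 2) * ?e z + ennreal (cmod (K z) powr 2) * ?e z) =
      ennreal (cmod (F z) powr 2) * ?e z + ennreal (cmod (G z) powr 2) * ?e z" for z
  proof -
    have "2 * ((cmod (H z))\<^sup>2 + (cmod (K z))\<^sup>2) = (cmod (F z))\<^sup>2 + (cmod (G z))\<^sup>2"
      unfolding cmod_power2 by (simp add: H_def K_def power2_eq_square field_simps)
    then have "ennreal 2 * (ennreal ((cmod (H z))\<^sup>2) + ennreal ((cmod (K z))\<^sup>2)) =
        ennreal ((cmod (F z))\<^sup>2) + ennreal ((cmod (G z))\<^sup>2)"
      by (simp flip: ennreal_plus ennreal_mult del: ennreal_numeral)
    then show ?thesis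
      by (simp flip: distrib_right mult.assoc)
  qed
  have "2 * (?W H + ?W K) = ?W F + ?W G"
    unfolding weighted_integral_lebesgue_on[OF \<Omega>]
    by (simp add: ptw del: powr_numeral distrib_left_numeral flip: nn_integral_add nn_integral_cmult)
  moreover have "?W F = ?W G"
    using F G by (auto simp: minimal_extension_def intro: antisym)
  ultimately have "2 * (?W H + ?W K) = 2 * ?W F" by (simp add: mult_2)
  then have sum: "?W H + ?W K = ?W F" by (simp add: ennreal_mult_cancel_left del: distrib_left_numeral)
  have finF: "?W F < \<infinity>" using F by (auto simp: defs)
  have "?W H \<le> ?W F" by (simp flip: sum)
  with finF have finH: "?W H < \<infinity>" by (rule le_less_trans[rotated])
  have "H \<in> extensions 2 \<Omega> S \<psi> f"
    using F G holH finH by (auto simp: defs H_def)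
  then have "?W F \<le> ?W H" using F by (auto simp: minimal_extension_def)
  \<comment> \<open>\<open>?W F + ?W K \<le> ?W H + ?W K = ?W F\<close>, and the finite term
    \<open>?W F\<close> can be cancelled.\<close>
  then have "?W K = 0"
    using sum finF ennreal_add_left_cancel_le[of "?W F" "?W K" 0]
      add_right_mono[of "?W F" "?W H" "?W K"] by auto
  then have "AE z in lebesgue_on \<Omega>. ennreal (cmod (K z) powr 2) * ?e z = 0"
    unfolding weighted_integral_lebesgue_on[OF \<Omega>] by (subst (asm) nn_integral_0_iff_AE) auto
  then have "AE z in lebesgue_on \<Omega>. F z = G z"
  proof (rule AE_mp, intro AE_I2 impI)
    fix z assume z: "z \<in> space (lebesgue_on \<Omega>)" "ennreal (cmod (K z) powr 2) * ?e z = 0"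
    have "?e z \<noteq> 0"
      using fin[of z] z(1) by (cases "\<psi> z") (auto simp: exp_ereal_def)
    then have "K z = 0" using z(2) by simp
    then show "F z = G z" by (simp add: K_def)
  qed
  then show ?thesis
    using AE_eq_imp_eq_on_open[OF \<Omega> hol[THEN holomorphic_Cn_continuous_on] _ z] by blast
qed

text \<open>Away from the zeros of \<open>F\<close> this is \<open>young_powr\<close> multiplied by
  the density of \<open>\<phi>\<close>. At a zero of \<open>F\<close> either \<open>g z = 0\<close>
  and the left side vanishes, or the right side is infinite.\<close>

lemma twisted_weight_young:
  fixes p :: real
  assumes "0 < p" "p < 2" "\<phi> z < \<infinity>"
  shows "ennreal (cmod (g z) powr p) * exp_ereal (- \<phi> z) \<le>
    ennreal (p / 2) * (ennreal (cmod (g z) powr 2) * exp_ereal (- twisted_weight p \<phi> F z)) +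
    ennreal (1 - p / 2) * (ennreal (cmod (F z) powr p) * exp_ereal (- \<phi> z))"
proof (cases "F z = 0")
  case True
  then show ?thesis using assms
    by (cases "g z = 0") (auto simp: exp_ereal_twisted_weight ennreal_mult_top)
next
  case False
  have "ennreal (cmod (g z) powr p) \<le>
    ennreal (p / 2) * (ennreal (cmod (g z) powr 2) * ennreal (cmod (F z) powr (p - 2))) +
    ennreal (1 - p / 2) * ennreal (cmod (F z) powr p)"
    using young_powr[of p "cmod (g z)" "cmod (F z)"] assms False
    by (simp flip: ennreal_mult ennreal_plus)
  from mult_right_mono[OF this, of "exp_ereal (- \<phi> z)"] show ?thesis
    using False assms by (simp add: exp_ereal_twisted_weight distrib_right mult.assoc)
qed

text \<open>The integrands agree pointwise: at zeros of \<open>F\<close> both vanish because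
  \<open>0 * \<infinity> = 0\<close>, and elsewhere the exponents \<open>2\<close> and
  \<open>p - 2\<close> add up to \<open>p\<close>.\<close>

lemma weighted_integral_twisted_weight_self:
  assumes "p < 2" "\<And>z. z \<in> \<Omega> \<Longrightarrow> \<phi> z < \<infinity>"
  shows "weighted_integral 2 \<Omega> (twisted_weight p \<phi> F) F = weighted_integral p \<Omega> \<phi> F"
  unfolding weighted_integral_def
proof (intro nn_integral_cong, goal_cases)
  case (1 z)
  show ?case
  proof (cases "F z = 0")
    case False
    have "cmod (F z) powr p = cmod (F z) powr 2 * cmod (F z) powr (p - 2)"
      by (simp flip: powr_add del: powr_numeral)
    then have "ennreal (cmod (F z) powr p) =
        ennreal (cmod (F z) powr 2) * ennreal (cmod (F z) powr (p - 2))"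
      by (simp only: ennreal_mult powr_ge_zero)
    then show ?thesis
      using False assms(1) assms(2)[of z]
      by (simp add: exp_ereal_twisted_weight mult.assoc indicator_def)
  qed simp
qed

theorem theorem5:
  fixes p :: real and k :: nat
    and \<Omega> S :: "(complex ^ 'n) set"
    and \<phi> :: "complex ^ 'n \<Rightarrow> ereal"
    and B :: "complex ^ 'n \<Rightarrow> real"
    and f F :: "complex ^ 'n \<Rightarrow> complex"
  assumes "0 < p" and "p < 2"
    and "bounded_pseudoconvex_domain \<Omega>"
    and "closed_complex_submanifold \<Omega> k S"
    and "plurisubharmonic_on \<Omega> \<phi>"
    and "ohsawa_takegoshi_function \<Omega> S k B"
    and "holomorphic_on_submanifold S k f"
    and "submanifold_integral p S k B \<phi> f < \<infinity>"
    and "minimal_extension p \<Omega> S \<phi> f F"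
  shows "minimal_extension 2 \<Omega> S (twisted_weight p \<phi> F) f F \<and>
         (\<forall>G. minimal_extension 2 \<Omega> S (twisted_weight p \<phi> F) f G \<longrightarrow> (\<forall>z\<in>\<Omega>. F z = G z))"
proof -
  let ?\<psi> = "twisted_weight p \<phi> F"
  let ?N = "weighted_integral p \<Omega> \<phi>" and ?A = "weighted_integral 2 \<Omega> ?\<psi>"
  note defs = minimal_extension_def extensions_def bergman_space_def
  have \<Omega>: "open \<Omega>" using assms(3) by (simp add: bounded_pseudoconvex_domain_def)
  have fin: "\<And>z. z \<in> \<Omega> \<Longrightarrow> \<phi> z < \<infinity>" and usc: "upper_semicontinuous_on \<Omega> \<phi>"
    using assms(5) by (auto simp: plurisubharmonic_on_def)
  have holF: "holomorphic_Cn F \<Omega>" and NF: "?N F < \<infinity>"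
    using assms(9) by (auto simp: defs)
  note [measurable] = upper_semicontinuous_on_borel_measurable[OF \<Omega> usc]
    holomorphic_Cn_measurable[OF \<Omega> holF]
  have meas\<psi> [measurable]: "?\<psi> \<in> borel_measurable (lebesgue_on \<Omega>)"
    unfolding twisted_weight_def [abs_def] by measurable
  have AF: "?A F = ?N F"
    using assms(2) fin by (rule weighted_integral_twisted_weight_self)
  have "?N F \<le> ?A g" if g: "g \<in> extensions 2 \<Omega> S ?\<psi> f" for g
  proof -
    have holg: "holomorphic_Cn g \<Omega>" and Ag: "?A g < \<infinity>"
      using g by (auto simp: defs)
    note [measurable] = holomorphic_Cn_measurable[OF \<Omega> holg]
    have "?N g \<le> (\<integral>\<^sup>+z. ennreal (p / 2) * (ennreal (cmod (g z) powr 2) * exp_ereal (- ?\<psi> z)) +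
        ennreal (1 - p / 2) * (ennreal (cmod (F z) powr p) * exp_ereal (- \<phi> z)) \<partial>lebesgue_on \<Omega>)"
      unfolding weighted_integral_lebesgue_on[OF \<Omega>] using assms(1,2) fin
      by (intro nn_integral_mono twisted_weight_young) auto
    also have "\<dots> = ennreal (p / 2) * ?A g + ennreal (1 - p / 2) * ?N F"
      unfolding weighted_integral_lebesgue_on[OF \<Omega>]
      by (subst nn_integral_add) (auto simp: nn_integral_cmult)
    finally have le: "?N g \<le> ennreal (p / 2) * ?A g + ennreal (1 - p / 2) * ?N F" .
    \<comment> \<open>Finiteness puts \<open>g\<close> into the \<open>p\<close>-Bergman space,
      where the minimality of \<open>F\<close> applies to it.\<close>
    also have "\<dots> < \<infinity>"
      using Ag NF by (auto simp: ennreal_mult_less_top)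
    finally have "g \<in> extensions p \<Omega> S \<phi> f"
      using g by (auto simp: defs)
    then have "?N F \<le> ?N g" using assms(9) by (auto simp: minimal_extension_def)
    with le have le: "?N F \<le> ennreal (p / 2) * ?A g + ennreal (1 - p / 2) * ?N F" by simp
    \<comment> \<open>Both integrals are finite, so the estimate can be read in the reals, where
      \<open>(1 - p / 2) * b\<close> may be subtracted; this leaves
      \<open>p * b \<le> p * a\<close>.\<close>
    obtain a b where ab: "0 \<le> a" "0 \<le> b" "?A g = ennreal a" "?N F = ennreal b"
      using Ag NF by (metis ennreal_cases less_irrefl infinity_ennreal_def)
    have "b \<le> p / 2 * a + (1 - p / 2) * b"
      using le ab assms(1,2) by (simp flip: ennreal_mult ennreal_plus)
    then have "p * b \<le> p * a" by (simp add: field_simps)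
    then show ?thesis using ab assms(1) by simp
  qed
  \<comment> \<open>By \<open>AF\<close> the finite \<open>p\<close>-integral of \<open>F\<close> is
    also its twisted integral, so \<open>F\<close> itself is a competitor in the twisted
    problem.\<close>
  then have min: "minimal_extension 2 \<Omega> S ?\<psi> f F"
    using assms(9) AF by (auto simp: defs)
  \<comment> \<open>Since \<open>2 - p\<close> is positive, zeros of \<open>F\<close> send the
    twisted weight to \<open>- \<infinity>\<close> and not to \<open>\<infinity>\<close>.\<close>
  have fin\<psi>: "?\<psi> z < \<infinity>" if "z \<in> \<Omega>" for z
    using fin[OF that] assms(2) by (cases "\<phi> z") (auto simp: twisted_weight_def log_abs_def)
  show ?thesis
    using min minimal_extension_2_unique[OF \<Omega> meas\<psi> fin\<psi> min] by blast
qed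

end
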